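(* Let $\mathbb F$ be a field of characteristic $p\geq3$, let $(L,[\cdot,\cdot],(\cdot)^{[p]})$ be a restricted Lie algebra over $\mathbb F$ and let $(m_t,\omega_t)=\big([\cdot,\cdot]+tm_1,\ (\cdot)^{[p]}+t\omega_1\big)$ be an infinitesimal restricted deformation of $L$, with $(m_1,\omega_1)\in C^2_*(L,L)$. Then this deformation is trivial if and only if $(m_1,\omega_1)$ is a restricted coboundary, i.e. $(m_1,\omega_1)\in B^2_*(L,L)$.
   Context: Restricted Lie algebra over a field $\mathbb F$ of characteristic $p$: a Lie algebra $L$ with a map $(\cdot)^{[p]}:L\to L$ such that $(\lambda x)^{[p]}=\lambda^p x^{[p]}$; $[x,y^{[p]}]=[[\cdots[x,y],y],\cdots,y]$ ($p$ copies of $y$); $(x+y)^{[p]}=x^{[p]}+y^{[p]}+\sum_{i=1}^{p-1}s_i(x,y)$, where $i\,s_i(x,y)$ is the coefficient of $Z^{i-1}$ in $\mathrm{ad}^{p-1}_{Zx+y}(x)$. Notation: $[x_1,\dots,x_n]:=[[\cdots[x_1,x_2],x_3],\cdots,x_n]$. $L$ acts on itself by $x\cdot m=[x,m]$. $C^n_{CE}(L,L)$ is the space of alternating $n$-linear maps $L^n\to L$. $C^2_*(L,L)$ is the set of pairs $(\varphi,\omega)$ with $\varphi\in C^2_{CE}(L,L)$ and $\omega:L\to L$ a map having the $( * )$-property with respect to $\varphi$: $\omega(\lambda x)=\lambda^p\omega(x)$ and $$\omega(x+y)=\omega(x)+\omega(y)+\sum_{\substack{x_i\in\{x,y\}\\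 x_1=x,\ x_2=y}}\frac1{\sharp\{x\}}\sum_{k=0}^{p-2}(-1)^k\,x_p\cdot x_{p-1}\cdots x_{p-k+1}\cdot\varphi([x_1,\dots,x_{p-k-1}],x_{p-k}),$$ where the outer sum is over $p$-tuples of symbols in $\{x,y\}$ with $x_1=x,x_2=y$, and $\sharp\{x\}$ is the number of $x_i$ equal to $x$. For a linear map $\psi:L\to L$, $d^1_*\psi=(d^1_{CE}\psi,\mathrm{ind}^1(\psi))$ with $d^1_{CE}\psi(x,y)=-\psi([x,y])+[x,\psi(y)]-[y,\psi(x)]$ and $\mathrm{ind}^1(\psi)(x)=-\psi(x^{[p]})+\mathrm{ad}_x^{p-1}(\psi(x))$; $B^2_*(L,L)=\{d^1_*\psi:\psi\in\mathrm{Hom}_{\mathbb F}(L,L)\}$. Infinitesimal means everything is taken modulo $t^2$: $m_t$ is extended $\mathbb F[t]$-bilinearly, $m_t$ satisfies the Jacobi identity modulo $t^2$ and $m_t(x,\omega_t(y))=m_t(m_t(\cdots m_t(x,y),y),\cdots,y)$ ($p$ copies of $y$) modulo $t^2$, for all $x,y\in L$. The infinitesimal deformation is trivial if there is $\phi_t=\sum_{i\ge0}t^i\phi_i$, with $\phi_i:L\to L$ linear, $\phi_0=\mathrm{id}$, extended by linearity in $t$, such that for all $x,y\in L$, modulo $t^2$: $\phi_t(m_t(x,y))=[\phi_t(x),\phi_t(y)]$ and $\phi_t(\omega_t(x))=(\phi_t(x))^{[p]}$, where $[\cdot,\cdot]$ is extended bilinearly in $t$ and the $p$-map is extended to $L[[t]]$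 by $(x+tu)^{[p]}=x^{[p]}+t^pu^{[p]}+\sum_{k=1}^{p-1}s_k(x,tu)$. *)

theory Defs
  imports
    "HOL-Computational_Algebra.Formal_Power_Series"
    "HOL-Computational_Algebra.Primes"
begin

text \<open>
  For a vector space \<open>L\<close> on a type \<open>'v\<close>, the space \<open>L[[t]]\<close> is \<open>'v fps\<close>; it contains \<open>L[t]\<close> and,
  through \<^const>\<open>fps_const\<close>, \<open>L\<close> itself.  The type \<open>'v\<close> carries no multiplication, so multiplication
  by the indeterminate is a shift of coefficients.
\<close>

definition fps_times_X :: "'a::zero fps \<Rightarrow> 'a fps" where
  "fps_times_X f = Abs_fps (\<lambda>n. if n = 0 then 0 else fps_nth f (n - 1))"

definition fps_scale :: "('f \<Rightarrow> 'a \<Rightarrow> 'a) \<Rightarrow> 'f \<Rightarrow> 'a fps \<Rightarrow> 'a fps" where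
  "fps_scale sc c f = Abs_fps (\<lambda>n. sc c (fps_nth f n))"

text \<open>The extension of a bilinear map that is bilinear over power series in the indeterminate;
  on polynomials it is the extension that is bilinear over polynomials.\<close>

definition fps_bilinear :: "('a \<Rightarrow> 'a \<Rightarrow> 'a::comm_monoid_add) \<Rightarrow> 'a fps \<Rightarrow> 'a fps \<Rightarrow> 'a fps" where
  "fps_bilinear B f g = Abs_fps (\<lambda>n. \<Sum>i\<le>n. B (fps_nth f i) (fps_nth g (n - i)))"

text \<open>The action of \<open>\<Sum>i. t^i \<phi> i\<close> on power series, extended linearly in \<open>t\<close>.\<close>

definition fps_family :: "(nat \<Rightarrow> 'a \<Rightarrow> 'a::comm_monoid_add) \<Rightarrow> 'a fps \<Rightarrow> 'a fps" where
  "fps_family \<phi> f = Abs_fps (\<lambda>n. \<Sum>i\<le>n. \<phi> i (fps_nth f (n - i)))"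

definition cong_mod_t2 :: "'a fps \<Rightarrow> 'a fps \<Rightarrow> bool" where
  "cong_mod_t2 f g \<longleftrightarrow> (\<forall>n<2. fps_nth f n = fps_nth g n)"

text \<open>
  Here power series are in the indeterminate \<open>Z\<close>: the operator iterated is \<open>ad (Z x + y)\<close>.
  The definition is used both for \<open>L\<close> and, with \<open>'a = 'v fps\<close>, for \<open>L[[t]]\<close>.
\<close>

definition jacobson_s ::
  "nat \<Rightarrow> ('f::field \<Rightarrow> 'a \<Rightarrow> 'a) \<Rightarrow> ('a \<Rightarrow> 'a \<Rightarrow> 'a::ab_group_add) \<Rightarrow> nat \<Rightarrow> 'a \<Rightarrow> 'a \<Rightarrow> 'a" where
  "jacobson_s p sc B i x y =
     sc (inverse (of_nat i))
       (fps_nth ((fps_bilinear B (fps_times_X (fps_const x) + fps_const y) ^^ (p - 1)) (fps_const x))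
          (i - 1))"

definition bilinear_map ::
  "('f::field \<Rightarrow> 'v \<Rightarrow> 'v) \<Rightarrow> ('v \<Rightarrow> 'v \<Rightarrow> 'v::ab_group_add) \<Rightarrow> bool" where
  "bilinear_map sc B \<longleftrightarrow>
     (\<forall>x. Vector_Spaces.linear sc sc (B x)) \<and> (\<forall>y. Vector_Spaces.linear sc sc (\<lambda>x. B x y))"

locale lie_algebra = vector_space scale
  for scale :: "'f::field \<Rightarrow> 'v::ab_group_add \<Rightarrow> 'v" +
  fixes bracket :: "'v \<Rightarrow> 'v \<Rightarrow> 'v"
  assumes bracket_bilinear: "bilinear_map scale bracket"
    and bracket_self: "bracket x x = 0"
    and jacobi: "bracket x (bracket y z) + bracket y (bracket z x) + bracket z (bracket x y) = 0"

locale restricted_lie_algebra = lie_algebra scale bracket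
  for scale :: "'f::field \<Rightarrow> 'v::ab_group_add \<Rightarrow> 'v" and bracket +
  fixes p :: nat
    and pmap :: "'v \<Rightarrow> 'v"
  assumes prime_p: "prime p"
    and char_p: "CHAR('f) = p"
    and pmap_scale: "pmap (scale c x) = scale (c ^ p) (pmap x)"
    and bracket_pmap: "bracket x (pmap y) = ((\<lambda>z. bracket z y) ^^ p) x"
    and pmap_add: "pmap (x + y) = pmap x + pmap y + (\<Sum>i=1..p-1. jacobson_s p scale bracket i x y)"
begin

text \<open>\<open>[x\<^sub>1, \<dots>, x\<^sub>n] = [[\<dots>[x\<^sub>1, x\<^sub>2], x\<^sub>3], \<dots>, x\<^sub>n]\<close> for a nonempty list.\<close>

definition left_bracket :: "'v list \<Rightarrow> 'v" where
  "left_bracket xs = foldl bracket (hd xs) (tl xs)"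

text \<open>\<open>x\<^sub>n \<cdot> x\<^sub>n\<^sub>-\<^sub>1 \<cdots> x\<^sub>1 \<cdot> m\<close> for the adjoint action \<open>x \<cdot> m = [x, m]\<close>: the head of the list acts first.\<close>

definition adjoint_action :: "'v list \<Rightarrow> 'v \<Rightarrow> 'v" where
  "adjoint_action xs m = fold bracket xs m"

definition C2_CE :: "('v \<Rightarrow> 'v \<Rightarrow> 'v) set" where
  "C2_CE = {\<phi>. bilinear_map scale \<phi> \<and> (\<forall>x. \<phi> x x = 0)}"

text \<open>
  A \<open>p\<close>-tuple of symbols in \<open>{x, y}\<close> is a list of booleans, \<^const>\<open>True\<close> standing for \<open>x\<close>; symbols are
  kept apart even if \<open>x = y\<close> in \<open>L\<close>.  Lists are indexed from 0, so that \<open>x\<^sub>j\<close> is \<open>xs ! (j - 1)\<close>.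
\<close>

definition star_words :: "bool list set" where
  "star_words = {w. length w = p \<and> w ! 0 = True \<and> w ! 1 = False}"

definition star_property :: "('v \<Rightarrow> 'v \<Rightarrow> 'v) \<Rightarrow> ('v \<Rightarrow> 'v) \<Rightarrow> bool" where
  "star_property \<phi> \<omega> \<longleftrightarrow>
     (\<forall>c x. \<omega> (scale c x) = scale (c ^ p) (\<omega> x)) \<and>
     (\<forall>x y. \<omega> (x + y) = \<omega> x + \<omega> y +
        (\<Sum>w\<in>star_words. let xs = map (\<lambda>b. if b then x else y) w in
           scale (inverse (of_nat (count_list w True)))
             (\<Sum>k=0..p-2. scale ((- 1) ^ k)
                (adjoint_action (drop (p - k) xs)
                   (\<phi> (left_bracket (take (p - k - 1) xs)) (xs ! (p - k - 1)))))))"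

definition C2_star :: "(('v \<Rightarrow> 'v \<Rightarrow> 'v) \<times> ('v \<Rightarrow> 'v)) set" where
  "C2_star = {(\<phi>, \<omega>). \<phi> \<in> C2_CE \<and> star_property \<phi> \<omega>}"

definition d1_CE :: "('v \<Rightarrow> 'v) \<Rightarrow> 'v \<Rightarrow> 'v \<Rightarrow> 'v" where
  "d1_CE \<psi> x y = - \<psi> (bracket x y) + bracket x (\<psi> y) - bracket y (\<psi> x)"

definition ind1 :: "('v \<Rightarrow> 'v) \<Rightarrow> 'v \<Rightarrow> 'v" where
  "ind1 \<psi> x = - \<psi> (pmap x) + (bracket x ^^ (p - 1)) (\<psi> x)"

definition d1_star :: "('v \<Rightarrow> 'v) \<Rightarrow> ('v \<Rightarrow> 'v \<Rightarrow> 'v) \<times> ('v \<Rightarrow> 'v)" where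
  "d1_star \<psi> = (d1_CE \<psi>, ind1 \<psi>)"

definition B2_star :: "(('v \<Rightarrow> 'v \<Rightarrow> 'v) \<times> ('v \<Rightarrow> 'v)) set" where
  "B2_star = {d1_star \<psi> | \<psi>. Vector_Spaces.linear scale scale \<psi>}"

definition m_t :: "('v \<Rightarrow> 'v \<Rightarrow> 'v) \<Rightarrow> 'v fps \<Rightarrow> 'v fps \<Rightarrow> 'v fps" where
  "m_t m1 f g = fps_bilinear bracket f g + fps_times_X (fps_bilinear m1 f g)"

definition \<omega>_t :: "('v \<Rightarrow> 'v) \<Rightarrow> 'v \<Rightarrow> 'v fps" where
  "\<omega>_t \<omega>1 x = fps_const (pmap x) + fps_times_X (fps_const (\<omega>1 x))"

definition infinitesimal_restricted_deformation :: "('v \<Rightarrow> 'v \<Rightarrow> 'v) \<Rightarrow> ('v \<Rightarrow> 'v) \<Rightarrow> bool" where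
  "infinitesimal_restricted_deformation m1 \<omega>1 \<longleftrightarrow>
     (\<forall>x y z. cong_mod_t2
        (m_t m1 (fps_const x) (m_t m1 (fps_const y) (fps_const z)) +
         m_t m1 (fps_const y) (m_t m1 (fps_const z) (fps_const x)) +
         m_t m1 (fps_const z) (m_t m1 (fps_const x) (fps_const y))) 0) \<and>
     (\<forall>x y. cong_mod_t2 (m_t m1 (fps_const x) (\<omega>_t \<omega>1 y))
        (((\<lambda>f. m_t m1 f (fps_const y)) ^^ p) (fps_const x)))"

text \<open>
  The \<open>p\<close>-map of \<open>L[[t]]\<close>.  Writing \<open>f = x + t u\<close> with \<open>x \<in> L\<close>, the defining formula determines the
  coefficients of \<open>f^{[p]}\<close> recursively, as the term \<open>t^p u^{[p]}\<close> contributes to the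
  coefficient of \<open>t^n\<close> the coefficient of \<open>t^{n-p}\<close> in \<open>u^{[p]}\<close>.
  The formula itself is recovered in \<open>pmap_fps_formula\<close> below.
\<close>

function pmap_coeff :: "'v fps \<Rightarrow> nat \<Rightarrow> 'v" where
  "pmap_coeff f n =
     (if n = 0 then pmap (fps_nth f 0) else 0) +
     (if n \<ge> p then pmap_coeff (fps_shift 1 f) (n - p) else 0) +
     fps_nth (\<Sum>k=1..p-1. jacobson_s p (fps_scale scale) (fps_bilinear bracket) k
        (fps_const (fps_nth f 0)) (fps_times_X (fps_shift 1 f))) n"
  by pat_completeness auto
termination
  by (relation "measure snd") (use prime_gt_0_nat[OF prime_p] in auto)

declare pmap_coeff.simps [simp del]

definition pmap_fps :: "'v fps \<Rightarrow> 'v fps" where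
  "pmap_fps f = Abs_fps (pmap_coeff f)"

lemma nth_fps_times_X: "fps_nth (fps_times_X f) n = (if n = 0 then 0 else fps_nth f (n - 1))"
  by (simp add: fps_times_X_def)

lemma nth_fps_times_X_power:
  "fps_nth ((fps_times_X ^^ j) f) n = (if n \<ge> j then fps_nth f (n - j) else 0)"
proof (induction j arbitrary: n)
  case (Suc j)
  show ?case by (cases n) (auto simp: nth_fps_times_X Suc)
qed simp

lemma pmap_fps_formula:
  "pmap_fps (fps_const x + fps_times_X u) =
     fps_const (pmap x) + (fps_times_X ^^ p) (pmap_fps u) +
     (\<Sum>k=1..p-1. jacobson_s p (fps_scale scale) (fps_bilinear bracket) k
        (fps_const x) (fps_times_X u))"
proof -
  have u: "fps_shift 1 (fps_const x + fps_times_X u) = u"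
    by (rule fps_ext) (simp add: fps_times_X_def)
  show ?thesis
    by (rule fps_ext)
      (simp only: pmap_fps_def fps_nth_Abs_fps pmap_coeff.simps[of "fps_const x + fps_times_X u"]
        u fps_add_nth fps_nth_fps_const nth_fps_times_X nth_fps_times_X_power
        simp_thms if_True if_False add_0_right)
qed

definition trivial_deformation :: "('v \<Rightarrow> 'v \<Rightarrow> 'v) \<Rightarrow> ('v \<Rightarrow> 'v) \<Rightarrow> bool" where
  "trivial_deformation m1 \<omega>1 \<longleftrightarrow>
     (\<exists>\<phi>. (\<forall>i. Vector_Spaces.linear scale scale (\<phi> i)) \<and> \<phi> 0 = id \<and>
        (\<forall>x y. cong_mod_t2 (fps_family \<phi> (m_t m1 (fps_const x) (fps_const y)))
           (fps_bilinear bracket (fps_family \<phi> (fps_const x)) (fps_family \<phi> (fps_const y)))) \<and>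
        (\<forall>x. cong_mod_t2 (fps_family \<phi> (\<omega>_t \<omega>1 x)) (pmap_fps (fps_family \<phi> (fps_const x)))))"

end

end

theory Submission
  imports Defs
begin

text \<open>
  Modulo \<open>t\<^sup>2\<close> only \<open>\<phi>\<^sub>1\<close> matters, and both triviality equations say \<open>(m\<^sub>1, \<omega>\<^sub>1) = d\<^sup>1\<^sub>* \<phi>\<^sub>1\<close>.
  For the bracket this is immediate.  For the \<open>p\<close>-map one needs \<open>\<Sum>\<^sub>k s\<^sub>k(x, tu)\<close> modulo \<open>t\<^sup>2\<close>: in
  \<open>ad(Zx + tu)\<^sup>p\<^sup>-\<^sup>1(x)\<close> the innermost factor must be \<open>tu\<close>, because \<open>[x, x] = 0\<close>, so all others
  are \<open>Zx\<close>.  Hence only \<open>s\<^sub>p\<^sub>-\<^sub>1\<close> contributes, with \<open>(p - 1) s\<^sub>p\<^sub>-\<^sub>1 \<equiv> t ad\<^sub>x\<^sup>p\<^sup>-\<^sup>2 [u, x]\<close>,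
  and \<open>p - 1 = -1\<close> in the field.
\<close>

lemma cong_mod_t2_iff:
  "cong_mod_t2 f g \<longleftrightarrow> fps_nth f 0 = fps_nth g 0 \<and> fps_nth f 1 = fps_nth g 1"
  by (auto simp: cong_mod_t2_def less_2_cases_iff)

lemma fps_nth_fps_scale [simp]: "fps_nth (fps_scale sc c f) n = sc c (fps_nth f n)"
  by (simp add: fps_scale_def)

lemma fps_bilinear_nth_0: "fps_nth (fps_bilinear B f g) 0 = B (fps_nth f 0) (fps_nth g 0)"
  by (simp add: fps_bilinear_def)

lemma fps_bilinear_nth_1:
  "fps_nth (fps_bilinear B f g) (Suc 0) =
     B (fps_nth f 0) (fps_nth g 1) + B (fps_nth f 1) (fps_nth g 0)"
  by (simp add: fps_bilinear_def)

lemma fps_family_nth_0: "fps_nth (fps_family \<phi> f) 0 = \<phi> 0 (fps_nth f 0)"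
  by (simp add: fps_family_def)

lemma fps_family_nth_1:
  "fps_nth (fps_family \<phi> f) (Suc 0) = \<phi> 0 (fps_nth f 1) + \<phi> 1 (fps_nth f 0)"
  by (simp add: fps_family_def)

text \<open>The polynomial \<open>Z a + b\<close> has only two coefficients, so the convolution
  reduces to two terms. \<open>B\<close> is kept general so that it can be
  \<open>fps_bilinear bracket\<close>, whose arguments are themselves series in
  \<open>t\<close>.\<close>

lemma fps_bilinear_linear_polynomial:
  fixes B :: "'a::comm_monoid_add \<Rightarrow> 'a \<Rightarrow> 'a"
  assumes "\<And>x. B 0 x = 0"
  shows "fps_nth (fps_bilinear B (fps_times_X (fps_const a) + fps_const b) f) n =
    B b (fps_nth f n) + (if n = 0 then 0 else B a (fps_nth f (n - 1)))"
proof (cases n)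
  case 0
  then show ?thesis
    by (simp add: fps_bilinear_def fps_times_X_def)
next
  case (Suc m)
  have "(\<Sum>i\<le>Suc m. B (fps_nth (fps_times_X (fps_const a) + fps_const b) i)
           (fps_nth f (Suc m - i))) =
        (\<Sum>i\<in>{0, 1}. B (fps_nth (fps_times_X (fps_const a) + fps_const b) i)
           (fps_nth f (Suc m - i)))"
    by (rule sum.mono_neutral_right) (auto simp: fps_times_X_def assms)
  then show ?thesis
    using Suc by (simp add: fps_bilinear_def fps_times_X_def)
qed

context lie_algebra
begin

lemma bracket_linear_right: "Vector_Spaces.linear scale scale (bracket x)"
  and bracket_linear_left: "Vector_Spaces.linear scale scale (\<lambda>x. bracket x y)"
  using bracket_bilinear by (auto simp: bilinear_map_def)

lemma bracket_add_right: "bracket x (y + z) = bracket x y + bracket x z"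
  and bracket_add_left: "bracket (x + y) z = bracket x z + bracket y z"
  using bracket_linear_right bracket_linear_left
  by (simp_all add: Vector_Spaces.linear_iff)

lemma bracket_zero_right [simp]: "bracket x 0 = 0"
  and bracket_zero_left [simp]: "bracket 0 x = 0"
  using bracket_add_right[of x 0 0] bracket_add_left[of 0 0 x] by simp_all

lemma bracket_minus_right: "bracket x (- y) = - bracket x y"
  using bracket_add_right[of x y "- y"] by (simp add: minus_unique)

lemma bracket_antisym: "bracket x y = - bracket y x"
  using bracket_self[of "x + y"]
  by (simp add: bracket_add_right bracket_add_left bracket_self[of x] bracket_self[of y]
      eq_neg_iff_add_eq_0 add.commute)

lemma bracket_funpow_minus: "(bracket x ^^ n) (- y) = - (bracket x ^^ n) y"
  by (induction n) (simp_all add: bracket_minus_right)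

text \<open>The outer index is the power of \<open>Z\<close>, the inner one the power of
  \<open>t\<close>. The first application of \<open>D\<close> leaves \<open>t [u, x]\<close> in
  degree 0 of \<open>Z\<close>, since \<open>[x, x] = 0\<close>. From then on everything is
  divisible by \<open>t\<close>, so modulo \<open_t2> each further application acts as
  \<open>Z ad x\<close>.\<close>

lemma ad_power_mod_t2:
  fixes x :: 'v and u :: "'v fps"
  defines "D \<equiv> fps_bilinear (fps_bilinear bracket)
    (fps_times_X (fps_const (fps_const x)) + fps_const (fps_times_X u))"
  shows "fps_nth (fps_nth ((D ^^ Suc j) (fps_const (fps_const x))) n) 0 = 0"
    and "fps_nth (fps_nth ((D ^^ Suc j) (fps_const (fps_const x))) n) (Suc 0) =
      (if n = j then (bracket x ^^ j) (bracket (fps_nth u 0) x) else 0)"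
proof -
  have D: "fps_nth (D f) n = fps_bilinear bracket (fps_times_X u) (fps_nth f n) +
      (if n = 0 then 0 else fps_bilinear bracket (fps_const x) (fps_nth f (n - 1)))" for f n
    unfolding D_def
    by (rule fps_bilinear_linear_polynomial) (auto simp: fps_bilinear_def intro: fps_ext)
  have D0: "fps_nth (fps_nth (D f) n) 0 =
      (if n = 0 then 0 else bracket x (fps_nth (fps_nth f (n - 1)) 0))" for f n
    by (simp add: D fps_bilinear_nth_0 fps_times_X_def)
  have D1: "fps_nth (fps_nth (D f) n) (Suc 0) =
      bracket (fps_nth u 0) (fps_nth (fps_nth f n) 0) +
      (if n = 0 then 0 else bracket x (fps_nth (fps_nth f (n - 1)) (Suc 0)))" for f n
    by (simp add: D fps_bilinear_nth_1 fps_times_X_def)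
  \<comment> \<open>Both coefficients are treated at once and for all \<open>n\<close>: by
    \<open>D1\<close>, the coefficient of \<open>t\<close> at \<open>n\<close> depends on the
    constant one at \<open>n\<close> and on the coefficient of \<open>t\<close> at
    \<open>n - 1\<close>.\<close>
  have "\<forall>n. fps_nth (fps_nth ((D ^^ Suc j) (fps_const (fps_const x))) n) 0 = 0 \<and>
    fps_nth (fps_nth ((D ^^ Suc j) (fps_const (fps_const x))) n) (Suc 0) =
      (if n = j then (bracket x ^^ j) (bracket (fps_nth u 0) x) else 0)"
  proof (induction j)
    case 0
    show ?case by (simp add: D0 D1 bracket_self)
  next
    case (Suc j)
    have step: "(D ^^ Suc (Suc j)) f = D ((D ^^ Suc j) f)" for f
      by simp
    show ?case
      unfolding step D0 D1 using Suc.IH by auto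
  qed
  then show "fps_nth (fps_nth ((D ^^ Suc j) (fps_const (fps_const x))) n) 0 = 0"
    and "fps_nth (fps_nth ((D ^^ Suc j) (fps_const (fps_const x))) n) (Suc 0) =
      (if n = j then (bracket x ^^ j) (bracket (fps_nth u 0) x) else 0)"
    by blast+
qed

lemma jacobson_s_mod_t2:
  assumes "p \<ge> 2" and "k \<ge> 1"
  shows "fps_nth (jacobson_s p (fps_scale scale) (fps_bilinear bracket) k
      (fps_const x) (fps_times_X u)) 0 = 0"
    and "fps_nth (jacobson_s p (fps_scale scale) (fps_bilinear bracket) k
      (fps_const x) (fps_times_X u)) (Suc 0) =
      (if k = p - 1
       then scale (inverse (of_nat k)) ((bracket x ^^ (p - 2)) (bracket (fps_nth u 0) x)) else 0)"
proof -
  have p: "p - 1 = Suc (p - 2)"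
    using assms by simp
  show "fps_nth (jacobson_s p (fps_scale scale) (fps_bilinear bracket) k
      (fps_const x) (fps_times_X u)) 0 = 0"
    unfolding jacobson_s_def p by (simp only: fps_nth_fps_scale ad_power_mod_t2 scale_zero_right)
  \<comment> \<open>Subtraction is truncated: for \<open>p = 2\<close> the left side would also hold
    at \<open>k = 0\<close>, which \<open>k \<ge> 1\<close> excludes.\<close>
  have k: "k - 1 = p - 2 \<longleftrightarrow> k = Suc (p - 2)"
    using assms by auto
  show "fps_nth (jacobson_s p (fps_scale scale) (fps_bilinear bracket) k
      (fps_const x) (fps_times_X u)) (Suc 0) =
      (if k = p - 1
       then scale (inverse (of_nat k)) ((bracket x ^^ (p - 2)) (bracket (fps_nth u 0) x)) else 0)"
    unfolding jacobson_s_def p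
    by (simp only: fps_nth_fps_scale ad_power_mod_t2 k scale_zero_right split: if_split) simp
qed

end

context restricted_lie_algebra
begin

lemma of_nat_p_minus_1: "(of_nat (p - 1) :: 'f) = - 1"
proof -
  have "(of_nat p :: 'f) = 0"
    using of_nat_CHAR[where 'a = 'f] by (simp add: char_p)
  then show ?thesis
    using prime_gt_0_nat[OF prime_p] by (simp add: of_nat_diff)
qed

lemma pmap_fps_nth_0: "fps_nth (pmap_fps f) 0 = pmap (fps_nth f 0)"
  using prime_ge_2_nat[OF prime_p]
  by (simp add: pmap_fps_def pmap_coeff.simps[of f 0] fps_sum_nth jacobson_s_mod_t2)

text \<open>This is the derivative of the \<open>p\<close>-map at \<open>x\<close> in direction
  \<open>u\<close>, the source of the second term of \<open>ind1\<close>. The summand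
  \<open>t^p u^[p]\<close> starts in degree \<open>p \<ge> 2\<close>, so only the Jacobson terms
  reach the coefficient of \<open>t\<close>.\<close>

lemma pmap_fps_nth_1:
  "fps_nth (pmap_fps f) (Suc 0) = (bracket (fps_nth f 0) ^^ (p - 1)) (fps_nth f 1)"
proof -
  define x u where "x = fps_nth f 0" and "u = fps_nth f 1"
  have p: "p \<ge> 2"
    using prime_ge_2_nat[OF prime_p] .
  have "fps_nth (pmap_fps f) (Suc 0) =
      (\<Sum>k=1..p-1. fps_nth (jacobson_s p (fps_scale scale) (fps_bilinear bracket) k
         (fps_const x) (fps_times_X (fps_shift 1 f))) (Suc 0))"
    using p by (simp add: pmap_fps_def pmap_coeff.simps[of f "Suc 0"] fps_sum_nth x_def)
  also have "\<dots> =
      (\<Sum>k=1..p-1. if k = p - 1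
         then scale (inverse (of_nat k)) ((bracket x ^^ (p - 2)) (bracket u x)) else 0)"
    using p by (intro sum.cong) (simp_all add: jacobson_s_mod_t2 u_def)
  also have "\<dots> = scale (inverse (of_nat (p - 1))) ((bracket x ^^ (p - 2)) (bracket u x))"
    using p by (subst sum.delta) auto
  also have "\<dots> = - (bracket x ^^ (p - 2)) (bracket u x)"
    by (simp only: of_nat_p_minus_1 inverse_minus_eq inverse_1 scale_minus_left scale_one)
  \<comment> \<open>Swapping \<open>u\<close> and \<open>x\<close> absorbs the sign that came from
    \<open>p - 1 = -1\<close>.\<close>
  also have "\<dots> = (bracket x ^^ (p - 2)) (bracket x u)"
    by (subst bracket_antisym) (simp add: bracket_funpow_minus)
  also have "\<dots> = (bracket x ^^ Suc (p - 2)) u"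
    by (simp only: funpow_Suc_right o_apply)
  also have "Suc (p - 2) = p - 1"
    using p by simp
  finally show ?thesis
    by (simp add: x_def u_def)
qed

text \<open>The constant coefficients agree because \<open>\<phi> 0 = id\<close>; those of
  \<open>t\<close> give
  \<open>m1 x y + \<phi> 1 [x, y] = [x, \<phi> 1 y] + [\<phi> 1 x, y]\<close>.\<close>

lemma fps_family_bracket_cong_iff:
  assumes "\<phi> 0 = id"
  shows "cong_mod_t2 (fps_family \<phi> (m_t m1 (fps_const x) (fps_const y)))
      (fps_bilinear bracket (fps_family \<phi> (fps_const x)) (fps_family \<phi> (fps_const y))) \<longleftrightarrow>
    m1 x y = d1_CE (\<phi> 1) x y"
proof -
  have "bracket (\<phi> (Suc 0) x) y = - bracket y (\<phi> (Suc 0) x)"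
    by (rule bracket_antisym)
  then show ?thesis
    using assms
    by (auto simp: cong_mod_t2_iff fps_family_nth_0 fps_family_nth_1 fps_bilinear_nth_0
        fps_bilinear_nth_1 m_t_def fps_times_X_def d1_CE_def algebra_simps)
qed

text \<open>Comparing coefficients of \<open>t\<close> gives
  \<open>\<omega>1 x + \<phi> 1 (pmap x)\<close> on the left and, by \<open>pmap_fps_nth_1\<close>,
  \<open>ad x\<close> applied \<open>p - 1\<close> times to \<open>\<phi> 1 x\<close> on the
  right.\<close>

lemma fps_family_pmap_cong_iff:
  assumes "\<phi> 0 = id"
  shows "cong_mod_t2 (fps_family \<phi> (\<omega>_t \<omega>1 x)) (pmap_fps (fps_family \<phi> (fps_const x))) \<longleftrightarrow>
    \<omega>1 x = ind1 (\<phi> 1) x"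
  using assms
  by (auto simp: cong_mod_t2_iff fps_family_nth_0 fps_family_nth_1 pmap_fps_nth_0 pmap_fps_nth_1
      \<omega>_t_def fps_times_X_def ind1_def algebra_simps)

lemma trivial_deformation_iff_B2_star:
  "trivial_deformation m1 \<omega>1 \<longleftrightarrow> (m1, \<omega>1) \<in> B2_star"
proof
  assume "trivial_deformation m1 \<omega>1"
  then obtain \<phi> where \<phi>: "\<And>i. Vector_Spaces.linear scale scale (\<phi> i)"
      "\<And>x y. m1 x y = d1_CE (\<phi> 1) x y" "\<And>x. \<omega>1 x = ind1 (\<phi> 1) x"
    by (force simp: trivial_deformation_def fps_family_bracket_cong_iff fps_family_pmap_cong_iff)
  then have "(m1, \<omega>1) = d1_star (\<phi> 1)"
    by (auto simp: d1_star_def fun_eq_iff)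
  with \<phi>(1) show "(m1, \<omega>1) \<in> B2_star"
    by (auto simp: B2_star_def)
next
  assume "(m1, \<omega>1) \<in> B2_star"
  then obtain \<psi> where \<psi>: "Vector_Spaces.linear scale scale \<psi>"
      "m1 = d1_CE \<psi>" "\<omega>1 = ind1 \<psi>"
    by (auto simp: B2_star_def d1_star_def)
  \<comment> \<open>The witness is \<open>id + t \<psi>\<close>; its higher coefficients are zero,
    hence linear.\<close>
  define \<phi> where "\<phi> = (\<lambda>i::nat. if i = 0 then id else if i = 1 then \<psi> else (\<lambda>_. 0))"
  have lin: "Vector_Spaces.linear scale scale (\<phi> i)" for i
    using \<psi>(1) by (auto simp: \<phi>_def Vector_Spaces.linear_iff algebra_simps vector_space_axioms)
  have \<phi>01: "\<phi> 0 = id" "\<phi> 1 = \<psi>"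
    by (simp_all add: \<phi>_def)
  show "trivial_deformation m1 \<omega>1"
    unfolding trivial_deformation_def
  proof (intro exI[of _ \<phi>] conjI allI)
    show "cong_mod_t2 (fps_family \<phi> (m_t m1 (fps_const x) (fps_const y)))
      (fps_bilinear bracket (fps_family \<phi> (fps_const x)) (fps_family \<phi> (fps_const y)))" for x y
      using \<phi>01 \<psi> by (simp only: fps_family_bracket_cong_iff)
    show "cong_mod_t2 (fps_family \<phi> (\<omega>_t \<omega>1 x)) (pmap_fps (fps_family \<phi> (fps_const x)))" for x
      using \<phi>01 \<psi> by (simp only: fps_family_pmap_cong_iff)
  qed (use lin \<phi>01 in auto)
qed

end

theorem proposition3p8:
  fixes scale :: "'f::field \<Rightarrow> 'v::ab_group_add \<Rightarrow> 'v"
    and bracket :: "'v \<Rightarrow> 'v \<Rightarrow> 'v"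
    and p :: nat
    and pmap :: "'v \<Rightarrow> 'v"
    and m1 :: "'v \<Rightarrow> 'v \<Rightarrow> 'v"
    and \<omega>1 :: "'v \<Rightarrow> 'v"
  assumes "restricted_lie_algebra scale bracket p pmap"
    and "p \<ge> 3"
    and "(m1, \<omega>1) \<in> restricted_lie_algebra.C2_star scale bracket p"
    and "restricted_lie_algebra.infinitesimal_restricted_deformation bracket p pmap m1 \<omega>1"
  shows "restricted_lie_algebra.trivial_deformation scale bracket p pmap m1 \<omega>1 \<longleftrightarrow>
    (m1, \<omega>1) \<in> restricted_lie_algebra.B2_star scale bracket p pmap"
  using assms(1) by (rule restricted_lie_algebra.trivial_deformation_iff_B2_star)

end
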